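(* Let $I\subset\mathbb{R}$ be an interval, let $a,b\in I$ with $a<b$, and let $f:I\to\mathbb{R}$ be twice differentiable on the interior $I^{\circ}$ of $I$, with $f''\in L_1[a,b]$. Let $q\ge 1$ and let $p$ be given by $\frac1p+\frac1q=1$. If $|f''|^q$ is quasi-convex on $[a,b]$, then $$\left|\frac{1}{b-a}\int_a^b f(x)\,dx-f\left(\frac{a+b}{2}\right)\right|\le \frac{(b-a)^2}{8(2p+1)^{1/p}}\left(\sup\left\{|f''(a)|^q,|f''(b)|^q\right\}\right)^{1/q}.$$
   Context: A function $g:[a,b]\to\mathbb{R}$ is quasi-convex on $[a,b]$ if $g(tx+(1-t)y)\le\sup\{g(x),g(y)\}$ for all $x,y\in[a,b]$ and $t\in[0,1]$. When $q=1$ one has $p=\infty$, and $(2p+1)^{1/p}$ is then understood as its limit $1$ as $p\to\infty$. The hypotheses on $f''$ over $[a,b]$ presuppose that $f$ is twice differentiable at every point of $[a,b]$; if $a$ or $b$ is an endpoint of $I$, the derivatives $f'$ and $f''$ there are understood as one-sided derivatives. *)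

theory Defs
  imports "HOL-Analysis.Analysis" "HOL-Real_Asymp.Real_Asymp"
begin

definition quasi_convex_on :: "real set \<Rightarrow> (real \<Rightarrow> real) \<Rightarrow> bool" where
  "quasi_convex_on S g \<longleftrightarrow>
     (\<forall>x\<in>S. \<forall>y\<in>S. \<forall>t\<in>{0..1}. g (t * x + (1 - t) * y) \<le> max (g x) (g y))"

text \<open>The factor \<open>(2p + 1)\<^sup>1\<^sup>/\<^sup>p\<close> for an exponent \<open>p \<in> [1, \<infinity>]\<close>; its value at \<open>\<infinity>\<close> is the limit
  as \<open>p \<rightarrow> \<infinity>\<close>, see \<open>exponent_factor_tendsto_top\<close>.\<close>

definition exponent_factor :: "ennreal \<Rightarrow> real" where
  "exponent_factor p =
     (if p = top then 1 else (2 * enn2real p + 1) powr (1 / enn2real p))"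

lemma exponent_factor_tendsto_top:
  "((\<lambda>r. exponent_factor (ennreal r)) \<longlongrightarrow> exponent_factor top) at_top"
proof -
  have "((\<lambda>r::real. (2 * r + 1) powr (1 / r)) \<longlongrightarrow> 1) at_top"
    by real_asymp
  moreover have "\<forall>\<^sub>F r in at_top. (2 * r + 1) powr (1 / r) = exponent_factor (ennreal r)"
    using eventually_ge_at_top[of 0] by eventually_elim (simp add: exponent_factor_def)
  ultimately show ?thesis
    by (simp add: exponent_factor_def[of top] tendsto_cong)
qed

end

theory Submission
  imports Defs
begin

text \<open>Quasi-convexity bounds \<open>\<bar>f''\<bar>\<close> on \<open>[a, b]\<close> by its larger endpoint value \<open>M\<close>. Comparing \<open>f\<close>
  with its tangent at the midpoint up to \<open>M/2 (x - m)\<^sup>2\<close> bounds the midpoint error by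
  \<open>M (b - a)\<^sup>2 / 24\<close>, and Bernoulli's inequality \<open>2p + 1 \<le> 3\<^sup>p\<close> gives \<open>(2p + 1)\<^sup>1\<^sup>/\<^sup>p \<le> 3\<close>.\<close>

lemma quasi_convex_on_Icc_bound:
  assumes "quasi_convex_on {a..b} g" and x: "x \<in> {a..b}" and "a < b"
  shows "g x \<le> max (g a) (g b)"
proof -
  \<comment> \<open>The weight that writes \<open>x\<close> as the convex combination
    \<open>t * a + (1 - t) * b\<close>.\<close>
  define t where "t = (b - x) / (b - a)"
  have t: "t \<in> {0..1}"
    using x \<open>a < b\<close> by (auto simp: t_def field_simps)
  have "t * (b - a) = b - x"
    using \<open>a < b\<close> by (simp add: t_def)
  then have "t * a + (1 - t) * b = x"
    by (simp add: algebra_simps)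
  then show ?thesis
    using assms t unfolding quasi_convex_on_def by (metis atLeastAtMost_iff less_imp_le order_refl)
qed

text \<open>Bernoulli's inequality for real exponents: the convex function \<open>x powr p\<close>
  lies above its tangent at 1.\<close>

lemma one_plus_mult_le_powr:
  fixes c p :: real
  assumes "c > -1" and "p \<ge> 1"
  shows "1 + c * p \<le> (1 + c) powr p"
proof -
  have "convex_on {0<..} (\<lambda>x. x powr p)"
    using powr_convex[OF assms(2)] by (rule convex_on_subset) auto
  then have "(1 + c) powr p - 1 powr p \<ge> p * (1 + c - 1)"
    by (rule convex_on_imp_above_tangent)
       (use assms in \<open>auto intro!: derivative_eq_intros simp: interior_open\<close>)
  then show ?thesis
    by (simp add: mult.commute)
qed

lemma exponent_factor_pos: "exponent_factor p > 0"
  using add_nonneg_pos[of "2 * enn2real p" 1] by (auto simp: exponent_factor_def)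

lemma exponent_factor_le_3:
  assumes "p \<ge> 1"
  shows "exponent_factor p \<le> 3"
proof (cases p)
  case (real r)
  then have r: "r \<ge> 1"
    using assms by simp
  have "(2 * r + 1) powr (1 / r) \<le> (3 powr r) powr (1 / r)"
    using one_plus_mult_le_powr[of 2 r] r by (intro powr_mono2) (auto simp: add.commute)
  also have "\<dots> = 3"
    using r by (simp add: powr_powr)
  finally show ?thesis
    using real by (simp add: exponent_factor_def)
qed (simp add: exponent_factor_def)

text \<open>Only an upper bound on \<open>h''\<close> enters, so the result is one-sided; applying
  it to both \<open>f\<close> and \<open>-f\<close> gives the absolute value. Derivatives are taken
  on the open interval, where they are two-sided.\<close>

lemma midpoint_error_upper:
  fixes h h' h'' :: "real \<Rightarrow> real"
  assumes "a < b" and h: "h integrable_on {a..b}"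
    and dh: "\<And>x. x \<in> {a<..<b} \<Longrightarrow> (h has_real_derivative h' x) (at x)"
    and dh': "\<And>x. x \<in> {a<..<b} \<Longrightarrow> (h' has_real_derivative h'' x) (at x)"
    and le: "\<And>x. x \<in> {a<..<b} \<Longrightarrow> h'' x \<le> M"
  shows "1 / (b - a) * integral {a..b} h - h ((a + b) / 2) \<le> M * (b - a)\<^sup>2 / 24"
proof -
  define m where "m = (a + b) / 2"
  have m: "m \<in> {a<..<b}"
    using \<open>a < b\<close> by (simp add: m_def)
  define u where "u x = h m + h' m * (x - m) + M / 2 * (x - m)\<^sup>2" for x
  \<comment> \<open>The second derivative is \<open>M - h''\<close>, which is nonnegative. The
    tangent of this function at \<open>m\<close> is \<open>- h m - h' m * (x - m)\<close>, and lying
    above it rearranges to \<open>h x \<le> u x\<close>.\<close>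
  have conv: "convex_on {a<..<b} (\<lambda>x. M / 2 * (x - m)\<^sup>2 - h x)"
  proof (rule f''_ge0_imp_convex)
    fix x assume x: "x \<in> {a<..<b}"
    show "((\<lambda>x. M / 2 * (x - m)\<^sup>2 - h x) has_real_derivative M * (x - m) - h' x) (at x)"
      using dh[OF x] by (auto intro!: derivative_eq_intros)
    show "((\<lambda>x. M * (x - m) - h' x) has_real_derivative M - h'' x) (at x)"
      using dh'[OF x] by (auto intro!: derivative_eq_intros)
    show "0 \<le> M - h'' x"
      using le[OF x] by simp
  qed auto
  have hu: "h x \<le> u x" if x: "x \<in> {a<..<b}" for x
  proof -
    have "((\<lambda>x. M / 2 * (x - m)\<^sup>2 - h x) has_real_derivative - h' m) (at m within {a<..<b})"
      using has_field_derivative_at_within[OF dh[OF m]] by (auto intro!: derivative_eq_intros)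
    from convex_on_imp_above_tangent[OF conv _ _ x this] m show ?thesis
      by (simp add: u_def interior_open algebra_simps)
  qed
  have u: "(u has_integral ((b - a) * h m + M * (b - a) ^ 3 / 24)) {a..b}"
  proof -
    define U where "U x = h m * x + h' m * (x - m)\<^sup>2 / 2 + M * (x - m) ^ 3 / 6" for x
    have "(u has_integral (U b - U a)) {a..b}"
    proof (rule fundamental_theorem_of_calculus)
      fix x assume "x \<in> {a..b}"
      show "(U has_vector_derivative u x) (at x within {a..b})"
        unfolding has_real_derivative_iff_has_vector_derivative[symmetric] U_def u_def
        by (auto intro!: derivative_eq_intros simp: power2_eq_square)
    qed (use \<open>a < b\<close> in simp)
    moreover have "U b - U a = (b - a) * h m + M * (b - a) ^ 3 / 24"
    proof -
      \<comment> \<open>In terms of the half-length the endpoints are symmetric about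
        \<open>m\<close>: the \<open>h' m\<close> terms cancel and the cubic terms add up to
        \<open>M * d ^ 3 / 3\<close>.\<close>
      define d where "d = (b - a) / 2"
      have "b - m = d" and "a - m = - d" and "b - a = 2 * d"
        by (simp_all add: m_def d_def field_simps)
      moreover have "b = a + 2 * d"
        by (simp add: d_def field_simps)
      ultimately show ?thesis
        unfolding U_def by (simp only:) (simp add: algebra_simps power3_eq_cube)
    qed
    ultimately show ?thesis by simp
  qed
  \<comment> \<open>The comparison \<open>hu\<close> holds on the open interval; dropping the two
    endpoints does not change the integrals.\<close>
  have "integral {a<..<b} h \<le> integral {a<..<b} u"
    using h u hu
    by (intro integral_le) (auto simp: integrable_on_open_interval_real has_integral_iff)
  then have "integral {a..b} h \<le> (b - a) * h m + M * (b - a) ^ 3 / 24"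
    using u by (simp add: integral_open_interval_real has_integral_iff)
  then have "1 / (b - a) * integral {a..b} h \<le> 1 / (b - a) * ((b - a) * h m + M * (b - a) ^ 3 / 24)"
    using \<open>a < b\<close> by (intro mult_left_mono) auto
  also have "\<dots> = h m + M * (b - a)\<^sup>2 / 24"
    using \<open>a < b\<close> by (simp add: distrib_left power3_eq_cube power2_eq_square)
  finally show ?thesis
    unfolding m_def by linarith
qed

theorem theorem7:
  fixes I :: "real set" and a b q :: real and p :: ennreal
    and f f' f'' :: "real \<Rightarrow> real"
  assumes "is_interval I" and "a \<in> I" and "b \<in> I" and "a < b"
    and "\<And>x. x \<in> interior I \<union> {a..b} \<Longrightarrow> (f has_real_derivative f' x) (at x within I)"
    and "\<And>x. x \<in> interior I \<union> {a..b} \<Longrightarrow> (f' has_real_derivative f'' x) (at x within I)"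
    and "f'' absolutely_integrable_on {a..b}"
    and "q \<ge> 1" and "1 / p + 1 / ennreal q = 1"
    and "quasi_convex_on {a..b} (\<lambda>x. \<bar>f'' x\<bar> powr q)"
  shows "\<bar>1 / (b - a) * integral {a..b} f - f ((a + b) / 2)\<bar>
    \<le> (b - a)\<^sup>2 / (8 * exponent_factor p)
      * (max (\<bar>f'' a\<bar> powr q) (\<bar>f'' b\<bar> powr q)) powr (1 / q)"
proof -
  define M where "M = (max (\<bar>f'' a\<bar> powr q) (\<bar>f'' b\<bar> powr q)) powr (1 / q)"
  have M: "\<bar>f'' x\<bar> \<le> M" if "x \<in> {a..b}" for x
  proof -
    \<comment> \<open>The \<open>q\<close>-th root is monotone, so it carries the quasi-convexity
      bound over to \<open>\<bar>f'' x\<bar>\<close>.\<close>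
    have "(\<bar>f'' x\<bar> powr q) powr (1 / q) \<le> M"
      unfolding M_def using quasi_convex_on_Icc_bound[OF assms(10) that assms(4)] assms(8)
      by (intro powr_mono2) auto
    then show ?thesis
      using assms(8) by (simp add: powr_powr)
  qed
  have sub: "{a..b} \<subseteq> I"
  proof
    fix x assume "x \<in> {a..b}"
    then show "x \<in> I"
      using mem_is_interval_1_I[OF assms(1-3)] by simp
  qed
  then have int: "{a<..<b} \<subseteq> interior I"
    by (intro interior_maximal) auto
  have df: "(f has_real_derivative f' x) (at x)"
    and df': "(f' has_real_derivative f'' x) (at x)" if "x \<in> {a<..<b}" for x
    using assms(5,6)[of x] int that at_within_interior[of x I] by auto
  \<comment> \<open>The derivatives within \<open>I\<close> also exist at \<open>a\<close> and
    \<open>b\<close>, so continuity reaches the endpoints.\<close>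
  have "continuous_on {a..b} f"
    using has_field_derivative_subset[OF assms(5) sub] by (intro DERIV_continuous_on) auto
  then have f: "f integrable_on {a..b}"
    by (rule integrable_continuous_real)
  have "1 / (b - a) * integral {a..b} f - f ((a + b) / 2) \<le> M * (b - a)\<^sup>2 / 24"
    using M by (intro midpoint_error_upper[OF assms(4) f df df']) (auto simp: abs_le_iff)
  moreover have "1 / (b - a) * integral {a..b} (\<lambda>x. - f x) - (- f ((a + b) / 2)) \<le> M * (b - a)\<^sup>2 / 24"
    using f df df' M
    by (intro midpoint_error_upper[OF assms(4), where h' = "\<lambda>x. - f' x" and h'' = "\<lambda>x. - f'' x"])
       (auto simp: abs_le_iff intro: DERIV_minus integrable_neg)
  ultimately have "\<bar>1 / (b - a) * integral {a..b} f - f ((a + b) / 2)\<bar> \<le> M * (b - a)\<^sup>2 / 24"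
    unfolding integral_neg mult_minus_right by linarith
  also have "\<dots> = (b - a)\<^sup>2 / (8 * 3) * M"
    by simp
  \<comment> \<open>Since the factor is at most 3, replacing 3 by it can only enlarge the
    bound.\<close>
  also have "\<dots> \<le> (b - a)\<^sup>2 / (8 * exponent_factor p) * M"
  proof -
    have le: "1 / p \<le> 1"
      by (rule ord_le_eq_trans[OF _ assms(9)]) simp
    have "p \<ge> 1"
    proof (cases p)
      case (real r)
      \<comment> \<open>In \<open>ennreal\<close>, \<open>1 / 0\<close> is \<open>top\<close>, which
        would exceed 1.\<close>
      have "r \<noteq> 0"
        using le real by (auto simp: top_unique)
      then show ?thesis
        using le real divide_ennreal[of 1 r] by (simp add: field_simps)
    qed simp
    then show ?thesis
      using exponent_factor_le_3[of p] exponent_factor_pos[of p]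
      by (intro mult_right_mono divide_left_mono) (auto simp: M_def)
  qed
  finally show ?thesis
    unfolding M_def .
qed

end
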